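(* Let $X$ be a normal space and $D$ be closed in $X$. Then $D$ is narrow in $X$ if and only if $D$ is f-narrow in $X$.
   Context: "Space" means Hausdorff topological space; normal spaces are Hausdorff. The longray $\mathbb{L}_{\ge 0}$ is $\omega_1\times[0,1)$ with the lexicographic order topology; $\alpha\in\omega_1$ is identified with $\langle\alpha,0\rangle$. A function into $\mathbb{L}_{\ge 0}$ is bounded if its range is contained in a strict initial segment. A systematic cover of $X$ indexed by $\omega_1$ is an open cover $\{U_\alpha:\alpha\in\omega_1\}$ with $\overline{U_\alpha}\subset U_\beta$ whenever $\alpha<\beta$. A closed $D\subset X$ is narrow in $X$ if for every systematic cover $\{U_\alpha:\alpha\in\omega_1\}$ of $X$, either $D\subset U_\alpha$ for some $\alpha$ or $\overline{U_\alpha}\cap D$ is Lindelöf for each $\alpha$. It is f-narrow (functionally narrow) in $X$ if for every continuous $f:X\to\mathbb{L}_{\ge 0}$, either $f\upharpoonright D$ is bounded or $f^{-1}([0,\alpha])\cap D$ is Lindelöf for each $\alpha\in\omega_1$. *)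

theory Defs
  imports "HOL-Analysis.Analysis" "HOL-Library.Countable_Set_Type"
begin

section \<open>The ordinal \<open>\<omega>\<^sub>1\<close>\<close>

text \<open>
  The elements of \<open>omega1\<close> are the countable ordinals: the type is well-ordered as the cardinal
  successor of \<open>natLeq\<close>. The lemmas \<open>uncountable_omega1\<close> and \<open>countable_lessThan_omega1\<close> below
  characterise this order type.
\<close>

typedef omega1 = "Field (cardSuc natLeq)"
  using Field_cardSuc_not_empty[OF natLeq_Card_order] by blast

lemma Well_order_omega1: "Well_order (cardSuc natLeq)"
  using cardSuc_Card_order[OF natLeq_Card_order] by (simp add: card_order_on_def)

instantiation omega1 :: linorder
begin

definition less_eq_omega1 :: "omega1 \<Rightarrow> omega1 \<Rightarrow> bool" where
  "a \<le> b \<longleftrightarrow> (Rep_omega1 a, Rep_omega1 b) \<in> cardSuc natLeq"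

definition less_omega1 :: "omega1 \<Rightarrow> omega1 \<Rightarrow> bool" where
  "a < b \<longleftrightarrow> a \<le> b \<and> \<not> b \<le> a" for a b :: omega1

instance
proof
  fix x y z :: omega1
  have R: "Refl (cardSuc natLeq)" "trans (cardSuc natLeq)" "antisym (cardSuc natLeq)"
    "Total (cardSuc natLeq)"
    using Well_order_omega1 by (auto simp: order_on_defs)
  show "(x < y) = (x \<le> y \<and> \<not> y \<le> x)"
    by (rule less_omega1_def)
  show x: "x \<le> x"
    using R(1) Rep_omega1[of x] by (simp add: less_eq_omega1_def refl_on_def)
  show "x \<le> y \<Longrightarrow> y \<le> z \<Longrightarrow> x \<le> z"
    using R(2) unfolding less_eq_omega1_def by (rule transD)
  show "x \<le> y \<Longrightarrow> y \<le> x \<Longrightarrow> x = y"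
    using R(3) unfolding less_eq_omega1_def by (metis Rep_omega1_inject antisymD)
  show "x \<le> y \<or> y \<le> x"
    using R(4) x Rep_omega1[of x] Rep_omega1[of y]
    unfolding less_eq_omega1_def total_on_def by metis
qed

end

lemma less_omega1_iff: "a < b \<longleftrightarrow> (Rep_omega1 a, Rep_omega1 b) \<in> cardSuc natLeq - Id"
  by (auto simp: less_le less_eq_omega1_def Rep_omega1_inject)

instance omega1 :: wellorder
proof
  fix P :: "omega1 \<Rightarrow> bool" and a
  assume step: "\<And>x. (\<And>y. y < x \<Longrightarrow> P y) \<Longrightarrow> P x"
  have "wf (inv_image (cardSuc natLeq - Id) Rep_omega1)"
    using Well_order_omega1 by (simp add: well_order_on_def)
  then show "P a"
    by (induction a rule: wf_induct_rule) (rule step, simp add: less_omega1_iff)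
qed

lemma bij_betw_Rep_omega1: "bij_betw Rep_omega1 UNIV (Field (cardSuc natLeq))"
  using type_definition.Rep_range[OF type_definition_omega1]
  by (simp add: bij_betw_def inj_def Rep_omega1_inject)

lemma uncountable_omega1:
  includes cardinal_syntax
  shows "uncountable (UNIV :: omega1 set)"
proof
  assume "countable (UNIV :: omega1 set)"
  then have "countable (Field (cardSuc natLeq))"
    using bij_betw_Rep_omega1 by (metis bij_betw_def countable_image)
  then have "|Field (cardSuc natLeq)| \<le>o natLeq"
    by (simp add: countable_card_le_natLeq)
  moreover have "natLeq <o |Field (cardSuc natLeq)|"
    using cardSuc_greater[OF natLeq_Card_order]
      card_of_Field_ordIso[OF cardSuc_Card_order[OF natLeq_Card_order]]
    by (meson ordIso_symmetric ordLess_ordIso_trans)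
  ultimately show False
    using not_ordLess_ordLeq by blast
qed

lemma countable_lessThan_omega1:
  includes cardinal_syntax
  shows "countable {..< a :: omega1}"
proof -
  have "|underS (cardSuc natLeq) (Rep_omega1 a)| <o cardSuc natLeq"
    using card_of_underS[OF cardSuc_Card_order[OF natLeq_Card_order] Rep_omega1] .
  then have "|underS (cardSuc natLeq) (Rep_omega1 a)| \<le>o natLeq"
    using cardSuc_ordLeq_ordLess[OF natLeq_Card_order card_of_Card_order] by blast
  then have "countable (underS (cardSuc natLeq) (Rep_omega1 a))"
    by (simp add: countable_card_le_natLeq)
  moreover have "Rep_omega1 ` {..<a} \<subseteq> underS (cardSuc natLeq) (Rep_omega1 a)"
    by (auto simp: underS_def less_omega1_iff)
  ultimately have "countable (Rep_omega1 ` {..<a})"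
    using countable_subset by blast
  then show ?thesis
    by (rule countable_image_inj_on) (simp add: inj_on_def Rep_omega1_inject)
qed


section \<open>The long ray\<close>

typedef longray = "(UNIV :: omega1 set) \<times> {0..<1 :: real}"
  by (rule exI[of _ "(undefined, 0)"]) simp

abbreviation ordinal_part :: "longray \<Rightarrow> omega1" where
  "ordinal_part x \<equiv> fst (Rep_longray x)"

abbreviation real_part :: "longray \<Rightarrow> real" where
  "real_part x \<equiv> snd (Rep_longray x)"

instantiation longray :: linorder
begin

definition less_eq_longray :: "longray \<Rightarrow> longray \<Rightarrow> bool" where
  "x \<le> y \<longleftrightarrow> ordinal_part x < ordinal_part y \<or>
    ordinal_part x = ordinal_part y \<and> real_part x \<le> real_part y"

definition less_longray :: "longray \<Rightarrow> longray \<Rightarrow> bool" where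
  "x < y \<longleftrightarrow> ordinal_part x < ordinal_part y \<or>
    ordinal_part x = ordinal_part y \<and> real_part x < real_part y"

instance
proof
  fix x y z :: longray
  show "(x < y) = (x \<le> y \<and> \<not> y \<le> x)" "x \<le> x" "x \<le> y \<Longrightarrow> y \<le> z \<Longrightarrow> x \<le> z" "x \<le> y \<or> y \<le> x"
    by (auto simp: less_eq_longray_def less_longray_def)
  show "x \<le> y \<Longrightarrow> y \<le> x \<Longrightarrow> x = y"
    by (auto simp: less_eq_longray_def prod_eq_iff simp flip: Rep_longray_inject)
qed

end

instantiation longray :: linorder_topology
begin

definition open_longray :: "longray set \<Rightarrow> bool" where
  "open_longray = generate_topology (range (\<lambda>a. {..<a}) \<union> range (\<lambda>a. {a<..}))"

instance
  by standard (rule open_longray_def)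

end

text \<open>The identification of \<open>\<alpha> \<in> \<omega>\<^sub>1\<close> with \<open>\<langle>\<alpha>, 0\<rangle>\<close>.\<close>

definition longray_of :: "omega1 \<Rightarrow> longray" where
  "longray_of \<alpha> = Abs_longray (\<alpha>, 0)"

instantiation longray :: zero
begin

definition zero_longray :: longray where
  "0 = longray_of (LEAST \<alpha>. True)"

instance ..

end

lemma Rep_longray_of: "Rep_longray (longray_of \<alpha>) = (\<alpha>, 0)"
  by (simp add: longray_of_def Abs_longray_inverse)

lemma longray_of_less_iff: "longray_of \<alpha> < longray_of \<beta> \<longleftrightarrow> \<alpha> < \<beta>"
  by (simp add: less_longray_def Rep_longray_of)

lemma zero_le_longray: "0 \<le> (x :: longray)"
proof -
  have "(LEAST \<alpha>. True) \<le> ordinal_part x"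
    by (rule Least_le) simp
  then show ?thesis
    using Rep_longray[of x]
    by (auto simp: less_eq_longray_def zero_longray_def Rep_longray_of mem_Times_iff)
qed


section \<open>Narrow and functionally narrow sets\<close>

definition systematic_cover :: "'a topology \<Rightarrow> (omega1 \<Rightarrow> 'a set) \<Rightarrow> bool" where
  "systematic_cover X U \<longleftrightarrow>
    (\<forall>\<alpha>. openin X (U \<alpha>)) \<and> (\<Union>\<alpha>. U \<alpha>) = topspace X \<and>
    (\<forall>\<alpha> \<beta>. \<alpha> < \<beta> \<longrightarrow> X closure_of U \<alpha> \<subseteq> U \<beta>)"

definition bounded_longray_on :: "'a set \<Rightarrow> ('a \<Rightarrow> longray) \<Rightarrow> bool" where
  "bounded_longray_on D f \<longleftrightarrow> (\<exists>b. f ` D \<subseteq> {..<b})"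

definition narrow_in :: "'a topology \<Rightarrow> 'a set \<Rightarrow> bool" where
  "narrow_in X D \<longleftrightarrow> closedin X D \<and>
    (\<forall>U. systematic_cover X U \<longrightarrow>
      (\<exists>\<alpha>. D \<subseteq> U \<alpha>) \<or>
      (\<forall>\<alpha>. Lindelof_space (subtopology X (X closure_of U \<alpha> \<inter> D))))"

definition f_narrow_in :: "'a topology \<Rightarrow> 'a set \<Rightarrow> bool" where
  "f_narrow_in X D \<longleftrightarrow> closedin X D \<and>
    (\<forall>f :: 'a \<Rightarrow> longray. continuous_map X euclidean f \<longrightarrow>
      bounded_longray_on D f \<or>
      (\<forall>\<alpha>. Lindelof_space (subtopology X
        ({x \<in> topspace X. f x \<in> {0..longray_of \<alpha>}} \<inter> D))))"

end

theory Submission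
  imports Defs
begin

text \<open>
  For the nontrivial direction, Urysohn's lemma gives \<open>g\<^sub>\<alpha> : X \<rightarrow> [0,1]\<close> that vanishes on the closure of
  \<open>U\<^sub>\<alpha>\<close> and is \<open>1\<close> off \<open>U\<^bsub>\<alpha>+1\<^esub>\<close>. For a point \<open>x\<close> the values \<open>g\<^sub>\<alpha> x\<close> are \<open>1\<close> up to some index and \<open>0\<close> beyond
  it, with at most one value in between, so they are glued to \<open>f x = \<langle>\<rho>, g\<^sub>\<rho> x\<rangle>\<close> where \<open>\<rho>\<close> is the
  least index with \<open>g\<^sub>\<rho> x < 1\<close>. Since \<open>f x > \<langle>\<gamma>, t\<rangle>\<close> if and only if \<open>g\<^sub>\<gamma> x > t\<close>, the map \<open>f\<close> is continuous; no
  separate treatment of limit ordinals is needed.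
\<close>

section \<open>Successors of countable ordinals and bounds in the long ray\<close>

text \<open>A greatest element would leave only countably many ordinals, since every proper initial
  segment is countable.\<close>

lemma ex_greater_omega1: "\<exists>\<beta>. (\<alpha> :: omega1) < \<beta>"
proof (rule ccontr)
  assume "\<nexists>\<beta>. \<alpha> < \<beta>"
  then have "(UNIV :: omega1 set) = insert \<alpha> {..<\<alpha>}"
    by (auto simp: not_less order.order_iff_strict)
  then show False
    using uncountable_omega1 countable_lessThan_omega1[of \<alpha>] by (metis countable_insert)
qed

definition succ_omega1 :: "omega1 \<Rightarrow> omega1" where
  "succ_omega1 \<alpha> = (LEAST \<beta>. \<alpha> < \<beta>)"

lemma less_succ_omega1: "\<alpha> < succ_omega1 \<alpha>"
  unfolding succ_omega1_def using ex_greater_omega1 by (rule LeastI_ex)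

lemma succ_omega1_le: "\<alpha> < \<beta> \<Longrightarrow> succ_omega1 \<alpha> \<le> \<beta>"
  unfolding succ_omega1_def by (rule Least_le)

lemma real_part_bounds: "0 \<le> real_part p" "real_part p < 1"
  using Rep_longray[of p] by (auto simp: mem_Times_iff)

lemma ex_less_longray_of: "\<exists>\<alpha>. p < longray_of \<alpha>"
  using ex_greater_omega1[of "ordinal_part p"] by (auto simp: less_longray_def Rep_longray_of)

section \<open>Continuity into ordered spaces, Lindelof subspaces, systematic covers\<close>

text \<open>The open rays form a subbasis of the order topology, and preimages commute with unions
  and finite intersections.\<close>

lemma continuous_map_into_linorder_topology:
  fixes f :: "'a \<Rightarrow> 'b :: linorder_topology"
  assumes "\<And>a. openin X {x \<in> topspace X. f x < a}" "\<And>a. openin X {x \<in> topspace X. a < f x}"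
  shows "continuous_map X euclidean f"
proof -
  have "openin X {x \<in> topspace X. f x \<in> U}" if "open U" for U
    using that unfolding open_generated_order
  proof (induction rule: generate_topology.induct)
    case UNIV
    then show ?case by simp
  next
    case (Int U V)
    moreover have "{x \<in> topspace X. f x \<in> U \<inter> V} =
        {x \<in> topspace X. f x \<in> U} \<inter> {x \<in> topspace X. f x \<in> V}"
      by auto
    ultimately show ?case by auto
  next
    case (UN K)
    moreover have "{x \<in> topspace X. f x \<in> \<Union>K} = (\<Union>U\<in>K. {x \<in> topspace X. f x \<in> U})"
      by auto
    ultimately show ?case by auto
  next
    case (Basis U)
    then show ?case using assms by auto
  qed
  then show ?thesis by (simp add: continuous_map_def)
qed

text \<open>Both directions use this to pass between sublevel sets of a map and closures of cover
  members, which are nested but rarely equal.\<close>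

lemma Lindelof_space_subtopology_closed_subset:
  assumes "Lindelof_space (subtopology X T)" "closedin X S" "S \<subseteq> T"
  shows "Lindelof_space (subtopology X S)"
proof -
  have "closedin (subtopology X T) S"
    using assms by (simp add: closedin_subset_topspace closedin_subtopology Int_absorb2) blast
  then have "Lindelof_space (subtopology (subtopology X T) S)"
    by (rule Lindelof_space_closedin_subtopology[OF assms(1)])
  then show ?thesis
    using assms(3) by (simp add: subtopology_subtopology Int_absorb1)
qed

lemma systematic_cover_mono:
  assumes "systematic_cover X U" "\<alpha> \<le> \<beta>"
  shows "U \<alpha> \<subseteq> U \<beta>"
proof (cases "\<alpha> = \<beta>")
  case False
  then have "X closure_of U \<alpha> \<subseteq> U \<beta>"
    using assms by (auto simp: systematic_cover_def)
  moreover have "U \<alpha> \<subseteq> X closure_of U \<alpha>"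
    using assms(1) by (simp add: systematic_cover_def closure_of_subset openin_subset)
  ultimately show ?thesis by blast
qed simp

section \<open>From narrow to f-narrow\<close>

text \<open>Ordinals are cofinal in the long ray, so these sets exhaust \<open>X\<close>. The closed
  set given by \<open>f x \<le> longray_of \<alpha>\<close> fits between any two of them with
  indices \<open>\<alpha> < \<beta>\<close>.\<close>

lemma systematic_cover_longray_preimage:
  assumes "continuous_map X euclidean f"
  shows "systematic_cover X (\<lambda>\<alpha>. {x \<in> topspace X. f x < longray_of \<alpha>})"
  unfolding systematic_cover_def
proof (intro conjI allI impI)
  show "openin X {x \<in> topspace X. f x < longray_of \<alpha>}" for \<alpha>
    using openin_continuous_map_preimage[OF assms, of "{..<longray_of \<alpha>}"] by simp
  show "(\<Union>\<alpha>. {x \<in> topspace X. f x < longray_of \<alpha>}) = topspace X"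
    using ex_less_longray_of by auto
  fix \<alpha> \<beta> :: omega1 assume "\<alpha> < \<beta>"
  have "closedin X {x \<in> topspace X. f x \<le> longray_of \<alpha>}"
    using closedin_continuous_map_preimage[OF assms, of "{..longray_of \<alpha>}"] by simp
  then have "X closure_of {x \<in> topspace X. f x < longray_of \<alpha>} \<subseteq>
      {x \<in> topspace X. f x \<le> longray_of \<alpha>}"
    by (rule closure_of_minimal[rotated]) auto
  also have "\<dots> \<subseteq> {x \<in> topspace X. f x < longray_of \<beta>}"
    using \<open>\<alpha> < \<beta>\<close> by (auto simp flip: longray_of_less_iff)
  finally show "X closure_of {x \<in> topspace X. f x < longray_of \<alpha>} \<subseteq>
      {x \<in> topspace X. f x < longray_of \<beta>}" .
qed

lemma narrow_in_imp_f_narrow_in: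
  assumes "narrow_in X D"
  shows "f_narrow_in X D"
  unfolding f_narrow_in_def
proof (intro conjI allI impI)
  show D: "closedin X D"
    using assms by (simp add: narrow_in_def)
  fix f :: "'a \<Rightarrow> longray" assume f: "continuous_map X euclidean f"
  define U where "U \<alpha> = {x \<in> topspace X. f x < longray_of \<alpha>}" for \<alpha>
  have "systematic_cover X U"
    using systematic_cover_longray_preimage[OF f] by (simp add: U_def[abs_def])
  then consider \<alpha> where "D \<subseteq> U \<alpha>"
    | "\<And>\<alpha>. Lindelof_space (subtopology X (X closure_of U \<alpha> \<inter> D))"
    using assms by (auto simp: narrow_in_def)
  then show "bounded_longray_on D f \<or> (\<forall>\<alpha>. Lindelof_space (subtopology X
      ({x \<in> topspace X. f x \<in> {0..longray_of \<alpha>}} \<inter> D)))"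
  proof cases
    case 1
    then show ?thesis by (auto simp: bounded_longray_on_def U_def)
  next
    case 2
    have "Lindelof_space (subtopology X ({x \<in> topspace X. f x \<in> {0..longray_of \<alpha>}} \<inter> D))" for \<alpha>
    proof (rule Lindelof_space_subtopology_closed_subset)
      \<comment> \<open>The successor is taken because \<open>U \<alpha>\<close> is defined by a
        strict inequality and omits the points that \<open>f\<close> maps to
        \<open>longray_of \<alpha>\<close>.\<close>
      show "Lindelof_space (subtopology X (X closure_of U (succ_omega1 \<alpha>) \<inter> D))"
        by (rule 2)
      show "closedin X ({x \<in> topspace X. f x \<in> {0..longray_of \<alpha>}} \<inter> D)"
        by (intro closedin_Int D closedin_continuous_map_preimage[OF f]) simp
      have "{x \<in> topspace X. f x \<in> {0..longray_of \<alpha>}} \<subseteq> U (succ_omega1 \<alpha>)"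
        using less_succ_omega1[of \<alpha>] by (auto simp: U_def simp flip: longray_of_less_iff)
      also have "\<dots> \<subseteq> X closure_of U (succ_omega1 \<alpha>)"
        by (rule closure_of_subset) (auto simp: U_def)
      finally show "{x \<in> topspace X. f x \<in> {0..longray_of \<alpha>}} \<inter> D \<subseteq>
          X closure_of U (succ_omega1 \<alpha>) \<inter> D"
        by blast
    qed
    then show ?thesis by blast
  qed
qed

section \<open>From f-narrow to narrow: gluing real functions into a long ray map\<close>

text \<open>The gluing depends only on the pattern of values at each point: once a value drops below
  1, all later ones vanish, and some value does drop.\<close>

lemma glue_longray_map:
  fixes g :: "omega1 \<Rightarrow> 'a \<Rightarrow> real"
  assumes cont: "\<And>\<alpha>. continuous_map X euclideanreal (g \<alpha>)"
    and g01: "\<And>\<alpha> x. x \<in> topspace X \<Longrightarrow> 0 \<le> g \<alpha> x \<and> g \<alpha> x \<le> 1"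
    and zero: "\<And>\<alpha> \<beta> x. \<lbrakk>x \<in> topspace X; \<alpha> < \<beta>; g \<alpha> x < 1\<rbrakk> \<Longrightarrow> g \<beta> x = 0"
    and ex: "\<And>x. x \<in> topspace X \<Longrightarrow> \<exists>\<alpha>. g \<alpha> x < 1"
  obtains f :: "'a \<Rightarrow> longray" where "continuous_map X euclidean f"
    and "\<And>p x. x \<in> topspace X \<Longrightarrow> f x \<le> p \<longleftrightarrow> g (ordinal_part p) x \<le> real_part p"
proof -
  define \<rho> where "\<rho> x = (LEAST \<alpha>. g \<alpha> x < 1)" for x
  define f where "f x = Abs_longray (\<rho> x, g (\<rho> x) x)" for x
  have \<rho>: "g (\<rho> x) x < 1" if "x \<in> topspace X" for x
    unfolding \<rho>_def using ex[OF that] by (rule LeastI_ex)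
  have Rep_f: "Rep_longray (f x) = (\<rho> x, g (\<rho> x) x)" if "x \<in> topspace X" for x
    using g01[OF that] \<rho>[OF that] by (simp add: f_def Abs_longray_inverse)
  have le_iff: "f x \<le> p \<longleftrightarrow> g (ordinal_part p) x \<le> real_part p" if x: "x \<in> topspace X" for p x
  \<comment> \<open>Past \<open>\<rho> x\<close> the values are 0, so both sides hold; before it,
    minimality makes them at least 1 while \<open>real_part p < 1\<close>, so both sides
    fail.\<close>
  proof (cases "\<rho> x" "ordinal_part p" rule: linorder_cases)
    case less
    then show ?thesis
      using zero[OF x less \<rho>[OF x]] real_part_bounds(1)[of p]
      by (simp add: less_eq_longray_def Rep_f[OF x])
  next
    case equal
    then show ?thesis by (simp add: less_eq_longray_def Rep_f[OF x])
  next
    case greater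
    then have "\<not> g (ordinal_part p) x < 1"
      unfolding \<rho>_def by (rule not_less_Least)
    then show ?thesis
      using greater real_part_bounds(2)[of p] by (simp add: less_eq_longray_def Rep_f[OF x])
  qed
  have "continuous_map X euclidean f"
  proof (rule continuous_map_into_linorder_topology)
    fix p
    have "{x \<in> topspace X. p < f x} =
        {x \<in> topspace X. g (ordinal_part p) x \<in> {real_part p<..}}"
      using le_iff by (auto simp flip: not_le)
    moreover have "openin X {x \<in> topspace X. g (ordinal_part p) x \<in> {real_part p<..}}"
      by (rule openin_continuous_map_preimage[OF cont]) simp
    ultimately show "openin X {x \<in> topspace X. p < f x}"
      by simp
    let ?A = "\<lambda>\<delta> t. {x \<in> topspace X. g \<delta> x \<in> {..<t}}"
    \<comment> \<open>If \<open>real_part p\<close> is 0, the first disjunct is void and the second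
      alone describes the ray. Its union over all smaller \<open>\<delta>\<close> treats successors
      and limits alike.\<close>
    have "f x < p \<longleftrightarrow> g (ordinal_part p) x < real_part p \<or> (\<exists>\<delta><ordinal_part p. g \<delta> x < 1)"
      if x: "x \<in> topspace X" for x
    proof
      assume "f x < p"
      then show "g (ordinal_part p) x < real_part p \<or> (\<exists>\<delta><ordinal_part p. g \<delta> x < 1)"
        using \<rho>[OF x] by (auto simp: less_longray_def Rep_f[OF x])
    next
      \<comment> \<open>The point with coordinates \<open>\<delta>\<close> and
        \<open>g \<delta> x\<close> separates \<open>f x\<close> from \<open>p\<close>: by
        \<open>le_iff\<close> it is an upper bound of \<open>f x\<close>. This serves both
        disjuncts.\<close>
      have *: "f x < p" if q: "g \<delta> x < 1"
        "\<delta> < ordinal_part p \<or> \<delta> = ordinal_part p \<and> g \<delta> x < real_part p" for \<delta>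
      proof -
        have Rep: "Rep_longray (Abs_longray (\<delta>, g \<delta> x)) = (\<delta>, g \<delta> x)"
          using g01[OF x] q(1) by (simp add: Abs_longray_inverse)
        then have "f x \<le> Abs_longray (\<delta>, g \<delta> x)"
          using le_iff[OF x] by simp
        also have "\<dots> < p"
          using q(2) by (auto simp: less_longray_def Rep)
        finally show ?thesis .
      qed
      assume "g (ordinal_part p) x < real_part p \<or> (\<exists>\<delta><ordinal_part p. g \<delta> x < 1)"
      then show "f x < p"
        using *[of "ordinal_part p"] * real_part_bounds(2)[of p] by (metis order.strict_trans)
    qed
    then have "{x \<in> topspace X. f x < p} =
        ?A (ordinal_part p) (real_part p) \<union> (\<Union>\<delta>\<in>{..<ordinal_part p}. ?A \<delta> 1)"
      by auto
    moreover have "openin X (?A \<delta> t)" for \<delta> t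
      by (rule openin_continuous_map_preimage[OF cont]) simp
    ultimately show "openin X {x \<in> topspace X. f x < p}"
      by (simp only:) (intro openin_Un openin_Union; blast)
  qed
  then show thesis
    using le_iff that by blast
qed

text \<open>Sublevel sets of \<open>f\<close> interleave with the cover. The upper inclusion loses
  one successor because the Urysohn function of index \<open>\<alpha>\<close> is known to be 1 only
  off \<open>U (succ_omega1 \<alpha>)\<close>.\<close>

lemma systematic_cover_separating_map:
  assumes "normal_space X" "systematic_cover X U"
  obtains f :: "'a \<Rightarrow> longray" where "continuous_map X euclidean f"
    and "\<And>\<alpha>. X closure_of U \<alpha> \<subseteq> {x \<in> topspace X. f x \<le> longray_of \<alpha>}"
    and "\<And>p. {x \<in> topspace X. f x \<le> p} \<subseteq> U (succ_omega1 (ordinal_part p))"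
proof -
  have "\<exists>g. continuous_map X (top_of_set {0..1::real}) g \<and>
      g ` (X closure_of U \<alpha>) \<subseteq> {0} \<and> g ` (topspace X - U (succ_omega1 \<alpha>)) \<subseteq> {1}" for \<alpha>
  proof -
    have "X closure_of U \<alpha> \<subseteq> U (succ_omega1 \<alpha>)"
      using assms(2) less_succ_omega1[of \<alpha>] unfolding systematic_cover_def by blast
    then have "disjnt (X closure_of U \<alpha>) (topspace X - U (succ_omega1 \<alpha>))"
      by (auto simp: disjnt_def)
    moreover have "closedin X (topspace X - U (succ_omega1 \<alpha>))"
      using assms(2) by (simp add: systematic_cover_def closedin_diff)
    ultimately obtain g where "continuous_map X (top_of_set {0..1::real}) g"
      "g ` (X closure_of U \<alpha>) \<subseteq> {0}" "g ` (topspace X - U (succ_omega1 \<alpha>)) \<subseteq> {1}"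
      using Urysohn_lemma[OF assms(1) closedin_closure_of _ _ zero_le_one] by blast
    then show ?thesis by blast
  qed
  then obtain g :: "omega1 \<Rightarrow> 'a \<Rightarrow> real" where
    "\<And>\<alpha>. continuous_map X (top_of_set {0..1}) (g \<alpha>) \<and>
      g \<alpha> ` (X closure_of U \<alpha>) \<subseteq> {0} \<and> g \<alpha> ` (topspace X - U (succ_omega1 \<alpha>)) \<subseteq> {1}"
    by metis
  then have g: "\<And>\<alpha>. continuous_map X (top_of_set {0..1}) (g \<alpha>)"
    and g0: "\<And>\<alpha> x. x \<in> X closure_of U \<alpha> \<Longrightarrow> g \<alpha> x = 0"
    and g1: "\<And>\<alpha> x. \<lbrakk>x \<in> topspace X; x \<notin> U (succ_omega1 \<alpha>)\<rbrakk> \<Longrightarrow> g \<alpha> x = 1"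
    by blast+
  have U: "U \<alpha> \<subseteq> X closure_of U \<alpha>" for \<alpha>
    using assms(2) by (simp add: systematic_cover_def closure_of_subset openin_subset)
  have "\<exists>f :: 'a \<Rightarrow> longray. continuous_map X euclidean f \<and>
      (\<forall>p. \<forall>x\<in>topspace X. f x \<le> p \<longleftrightarrow> g (ordinal_part p) x \<le> real_part p)"
  proof (rule glue_longray_map[of X g])
    show "continuous_map X euclideanreal (g \<alpha>)" for \<alpha>
      using g by (simp add: continuous_map_in_subtopology)
    show "0 \<le> g \<alpha> x \<and> g \<alpha> x \<le> 1" if "x \<in> topspace X" for \<alpha> x
      using g[of \<alpha>] that by (auto simp: continuous_map_in_subtopology)
    show "g \<beta> x = 0" if "x \<in> topspace X" "\<alpha> < \<beta>" "g \<alpha> x < 1" for \<alpha> \<beta> x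
    proof -
      \<comment> \<open>A value below 1 forces \<open>x\<close> into the successor member, hence
        into \<open>U \<beta>\<close>, on whose closure \<open>g \<beta>\<close> vanishes.\<close>
      have "x \<in> U (succ_omega1 \<alpha>)"
        using that g1[of x \<alpha>] by force
      then have "x \<in> U \<beta>"
        using systematic_cover_mono[OF assms(2) succ_omega1_le] that(2) by blast
      then show ?thesis
        using U g0 by blast
    qed
    show "\<exists>\<alpha>. g \<alpha> x < 1" if x: "x \<in> topspace X" for x
    proof -
      obtain \<alpha> where "x \<in> U \<alpha>"
        using x assms(2) unfolding systematic_cover_def by blast
      then have "g \<alpha> x = 0"
        using U g0 by blast
      then show ?thesis
        by (metis zero_less_one)
    qed
  qed blast
  then obtain f :: "'a \<Rightarrow> longray" where f: "continuous_map X euclidean f"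
    and le_iff: "\<And>p x. x \<in> topspace X \<Longrightarrow> f x \<le> p \<longleftrightarrow> g (ordinal_part p) x \<le> real_part p"
    by blast
  show thesis
  proof
    show "continuous_map X euclidean f" by (rule f)
    show "X closure_of U \<alpha> \<subseteq> {x \<in> topspace X. f x \<le> longray_of \<alpha>}" for \<alpha>
      using closure_of_subset_topspace[of X "U \<alpha>"] by (auto simp: le_iff Rep_longray_of g0)
    show "{x \<in> topspace X. f x \<le> p} \<subseteq> U (succ_omega1 (ordinal_part p))" for p
      using real_part_bounds(2)[of p] g1 by (force simp: le_iff)
  qed
qed

text \<open>The interleaving transfers each alternative: a bound of \<open>f\<close> on
  \<open>D\<close> puts \<open>D\<close> inside one cover member, and Lindelof sublevel sets contain
  the closures of the cover members.\<close>

lemma f_narrow_in_imp_narrow_in: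
  assumes "normal_space X" "f_narrow_in X D"
  shows "narrow_in X D"
  unfolding narrow_in_def
proof (intro conjI allI impI)
  show D: "closedin X D"
    using assms by (simp add: f_narrow_in_def)
  fix U :: "omega1 \<Rightarrow> 'a set" assume "systematic_cover X U"
  then obtain f :: "'a \<Rightarrow> longray" where f: "continuous_map X euclidean f"
    and below: "\<And>\<alpha>. X closure_of U \<alpha> \<subseteq> {x \<in> topspace X. f x \<le> longray_of \<alpha>}"
    and above: "\<And>p. {x \<in> topspace X. f x \<le> p} \<subseteq> U (succ_omega1 (ordinal_part p))"
    using systematic_cover_separating_map[OF assms(1)] by blast
  from f assms(2) consider b where "f ` D \<subseteq> {..<b}"
    | "\<And>\<alpha>. Lindelof_space (subtopology X ({x \<in> topspace X. f x \<in> {0..longray_of \<alpha>}} \<inter> D))"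
    unfolding f_narrow_in_def bounded_longray_on_def by blast
  then show "(\<exists>\<alpha>. D \<subseteq> U \<alpha>) \<or> (\<forall>\<alpha>. Lindelof_space (subtopology X (X closure_of U \<alpha> \<inter> D)))"
  proof cases
    case 1
    then have "D \<subseteq> {x \<in> topspace X. f x \<le> b}"
      using closedin_subset[OF D] by force
    then show ?thesis using above by blast
  next
    case 2
    have "X closure_of U \<alpha> \<inter> D \<subseteq> {x \<in> topspace X. f x \<in> {0..longray_of \<alpha>}} \<inter> D" for \<alpha>
      using below[of \<alpha>] by (auto simp: zero_le_longray)
    then show ?thesis
      using Lindelof_space_subtopology_closed_subset[OF 2] D by (meson closedin_Int closedin_closure_of)
  qed
qed

theorem lemma3p9:
  fixes X :: "'a topology" and D :: "'a set"
  assumes "Hausdorff_space X" and "normal_space X" and "closedin X D"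
  shows "narrow_in X D \<longleftrightarrow> f_narrow_in X D"
  using narrow_in_imp_f_narrow_in f_narrow_in_imp_narrow_in[OF assms(2)] by blast

end
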